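(* Let $f$ be a homeomorphism of $\mathbb{T}^2$ that is isotopic to the identity and let $\check f$ be a lift of $f$ to $\mathbb{R}^2$. Assume that $\mathrm{rot}(\check f)$ has a non empty interior, and let $L$ be a constant such that $d(\check f^n(z)-z,\,n\,\mathrm{rot}(\check f))\leq L$ for every $z\in\mathbb{R}^2$ and every $n\geq1$ (such a constant exists). Let $\psi$ be a non trivial linear form on $\mathbb{R}^2$ and set $$\alpha(\psi)=\max_{\mu\in\mathcal{M}(f)}\psi(\mathrm{rot}(\mu)),\quad \mathcal{M}_{\psi}=\{\mu\in\mathcal{M}(f):\psi(\mathrm{rot}(\mu))=\alpha(\psi)\},\quad X_{\psi}=\overline{\bigcup_{\mu\in\mathcal{M}_{\psi}}\mathrm{supp}(\mu)}.$$ Then every $f$-invariant Borel probability measure supported on $X_{\psi}$ belongs to $\mathcal{M}_{\psi}$. Moreover, if $z\in\mathbb{R}^2$ lifts a point of $X_{\psi}$, then for every $n\geq 1$ one has $$\big|\psi(\check f^n(z))-\psi(z)-n\,\alpha(\psi)\big|\leq L\,\Vert\psi\Vert.$$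
   Context: $\mathbb{T}^2=\mathbb{R}^2/\mathbb{Z}^2$. $\mathcal{M}(f)$ is the set of $f$-invariant Borel probability measures. The map $\check f-\mathrm{Id}$ is $\mathbb{Z}^2$-periodic, hence it is the lift of a continuous map $\varphi:\mathbb{T}^2\to\mathbb{R}^2$; the rotation vector of $\mu\in\mathcal{M}(f)$ is $\mathrm{rot}(\mu)=\int_{\mathbb{T}^2}\varphi\,d\mu$, and $\mathrm{rot}(\check f)=\{\mathrm{rot}(\mu):\mu\in\mathcal{M}(f)\}$, a non empty compact convex subset of $\mathbb{R}^2$. $d(z,X)=\inf_{z'\in X}\Vert z-z'\Vert$ with the Euclidean norm, and $\Vert\psi\Vert$ is the associated operator norm of $\psi$. *)

theory Defs
  imports "HOL-Probability.Probability"
begin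

definition lattice_equiv :: "real^2 \<Rightarrow> real^2 \<Rightarrow> bool" where
  "lattice_equiv x y \<longleftrightarrow> (\<forall>i. x $ i - y $ i \<in> \<int>)"

lemma equivp_lattice_equiv: "equivp lattice_equiv"
proof (rule equivpI)
  show "reflp lattice_equiv"
    by (simp add: reflp_def lattice_equiv_def)
  show "symp lattice_equiv"
    unfolding symp_def lattice_equiv_def by (metis Ints_minus minus_diff_eq)
  show "transp lattice_equiv"
    unfolding transp_def lattice_equiv_def
  proof (intro allI impI)
    fix x y z :: "real^2" and i
    assume "\<forall>i. x $ i - y $ i \<in> \<int>" "\<forall>i. y $ i - z $ i \<in> \<int>"
    then have "(x $ i - y $ i) + (y $ i - z $ i) \<in> \<int>"
      by (intro Ints_add) auto
    then show "x $ i - z $ i \<in> \<int>" by simp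
  qed
qed

quotient_type torus = "real^2" / lattice_equiv
  morphisms torus_rep torus_proj
  by (rule equivp_lattice_equiv)

lemma torus_proj_eq_iff: "torus_proj x = torus_proj y \<longleftrightarrow> (\<forall>i. x $ i - y $ i \<in> \<int>)"
  by (simp add: torus.abs_eq_iff lattice_equiv_def)

lemma surj_torus_proj: "surj torus_proj"
  by (metis Quotient_torus Quotient_abs_rep surjI)

text \<open>The quotient topology; \<open>borel\<close>, \<open>closure\<close>, \<open>homeomorphism\<close> etc. on
  \<^typ>\<open>torus\<close> all refer to it.\<close>

instantiation torus :: topological_space
begin

definition open_torus :: "torus set \<Rightarrow> bool" where
  "open_torus U \<longleftrightarrow> open (torus_proj -` U)"

instance
  by standard (auto simp: open_torus_def vimage_Union)

end

definition homeo :: "('a::topological_space \<Rightarrow> 'a) \<Rightarrow> bool" where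
  "homeo f \<longleftrightarrow> (\<exists>g. homeomorphism UNIV UNIV f g)"

definition isotopic_to_id :: "('a::topological_space \<Rightarrow> 'a) \<Rightarrow> bool" where
  "isotopic_to_id f \<longleftrightarrow> homotopic_with_canon homeo UNIV UNIV id f"

definition is_lift :: "(real^2 \<Rightarrow> real^2) \<Rightarrow> (torus \<Rightarrow> torus) \<Rightarrow> bool" where
  "is_lift F f \<longleftrightarrow> continuous_on UNIV F \<and> (\<forall>z. torus_proj (F z) = f (torus_proj z))"

text \<open>The function on the torus of which \<open>F - Id\<close> is the lift. It exists only if
  \<open>F - Id\<close> is periodic with respect to the integer lattice; then it is unique.\<close>

definition displacement :: "(real^2 \<Rightarrow> real^2) \<Rightarrow> torus \<Rightarrow> real^2" where
  "displacement F = (THE \<phi>. \<forall>z. \<phi> (torus_proj z) = F z - z)"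

lemma displacement_torus_proj:
  assumes "\<And>x y. torus_proj x = torus_proj y \<Longrightarrow> F x - x = F y - y"
  shows "displacement F (torus_proj z) = F z - z"
proof -
  let ?P = "\<lambda>\<phi>. \<forall>z. \<phi> (torus_proj z) = F z - z"
  have P: "?P (\<lambda>x. F (inv torus_proj x) - inv torus_proj x)"
    by (metis assms surj_f_inv_f surj_torus_proj)
  have uniq: "\<phi> = \<phi>'" if "?P \<phi>" "?P \<phi>'" for \<phi> \<phi>'
    using that surj_torus_proj by (metis ext surjD)
  have "\<exists>!\<phi>. ?P \<phi>"
    by (rule ex1I[where P = ?P, OF P]) (rule uniq[OF _ P])
  then have "?P (displacement F)"
    unfolding displacement_def by (rule theI')
  then show ?thesis by blast
qed

definition invariant_measures :: "('a::topological_space \<Rightarrow> 'a) \<Rightarrow> 'a measure set" where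
  "invariant_measures f = {\<mu>. prob_space \<mu> \<and> sets \<mu> = sets borel \<and> distr \<mu> borel f = \<mu>}"

definition supp :: "'a::topological_space measure \<Rightarrow> 'a set" where
  "supp \<mu> = {x. \<forall>U. open U \<longrightarrow> x \<in> U \<longrightarrow> emeasure \<mu> U > 0}"

definition rot :: "(real^2 \<Rightarrow> real^2) \<Rightarrow> torus measure \<Rightarrow> real^2" where
  "rot F \<mu> = (\<integral>x. displacement F x \<partial>\<mu>)"

definition rotation_set :: "(torus \<Rightarrow> torus) \<Rightarrow> (real^2 \<Rightarrow> real^2) \<Rightarrow> (real^2) set" where
  "rotation_set f F = rot F ` invariant_measures f"

text \<open>\<open>GREATEST\<close> is a genuine maximum: nothing can be derived about \<open>max_rot\<close> without
  showing that the maximum is attained.\<close>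

definition max_rot :: "(torus \<Rightarrow> torus) \<Rightarrow> (real^2 \<Rightarrow> real^2) \<Rightarrow> (real^2 \<Rightarrow> real) \<Rightarrow> real" where
  "max_rot f F \<psi> = (GREATEST a. \<exists>\<mu>\<in>invariant_measures f. a = \<psi> (rot F \<mu>))"

definition maximizing_measures ::
    "(torus \<Rightarrow> torus) \<Rightarrow> (real^2 \<Rightarrow> real^2) \<Rightarrow> (real^2 \<Rightarrow> real) \<Rightarrow> torus measure set" where
  "maximizing_measures f F \<psi> = {\<mu> \<in> invariant_measures f. \<psi> (rot F \<mu>) = max_rot f F \<psi>}"

definition maximizing_set ::
    "(torus \<Rightarrow> torus) \<Rightarrow> (real^2 \<Rightarrow> real^2) \<Rightarrow> (real^2 \<Rightarrow> real) \<Rightarrow> torus set" where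
  "maximizing_set f F \<psi> = closure (\<Union>\<mu>\<in>maximizing_measures f F \<psi>. supp \<mu>)"

end

theory Submission
  imports Defs "HOL-Complex_Analysis.Winding_Numbers"
begin

text \<open>Put \<open>g = \<psi> \<circ> \<phi> - \<alpha>(\<psi>)\<close> and let \<open>S\<^sub>n\<close> be its Birkhoff sums. The hypothesis on \<open>L\<close> gives
  \<open>S\<^sub>n \<le> C = L \<parallel>\<psi>\<parallel>\<close> everywhere, so \<open>u = sup\<^sub>n S\<^sub>n\<close> is bounded and \<open>u - u \<circ> f - g \<ge> 0\<close>. For a
  maximizing measure this function has integral \<open>0\<close>, hence vanishes almost everywhere, and \<open>g\<close> is
  a coboundary of a function with values in \<open>[0, C]\<close>; thus \<open>\<bar>S\<^sub>n\<bar> \<le> C\<close> almost everywhere and, this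
  being a closed condition, on the supports and on the closure of their union. Conversely, a measure
  supported there satisfies \<open>n \<bar>\<integral>g\<bar> \<le> C\<close> for all \<open>n\<close>.

  The maximum is attained because the invariant measures are weakly sequentially compact.
  This is deduced from Helly's theorem on the real line, to which measures on the torus are
  transported by a Borel section of a space-filling curve. That \<open>F - Id\<close> is periodic follows from
  the invariance of winding numbers under the isotopy.\<close>

subsection \<open>Topology of the torus\<close>

lemma continuous_on_torus_proj: "continuous_on A torus_proj"
proof -
  have "continuous_on UNIV torus_proj"
    by (subst continuous_on_open_vimage) (auto simp: open_torus_def)
  then show ?thesis by (rule continuous_on_subset) auto
qed

lemma continuous_on_torusI:
  fixes g :: "torus \<Rightarrow> 'a::topological_space"
  assumes "continuous_on UNIV (\<lambda>z. g (torus_proj z))"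
  shows "continuous_on UNIV g"
proof -
  have "open (g -` B)" if "open B" for B
    using open_vimage[OF that assms] by (simp add: open_torus_def vimage_def)
  then show ?thesis
    by (subst continuous_on_open_vimage) auto
qed

lemma torus_proj_torus_rep [simp]: "torus_proj (torus_rep q) = q"
  by (metis Quotient_torus Quotient_abs_rep)

text \<open>\<open>torus_rep\<close> picks an arbitrary representative; fractional parts normalize
  it to the one in [0,1)^2, which gives explicit formulas on the torus.\<close>

definition frac_coord :: "torus \<Rightarrow> 2 \<Rightarrow> real" where
  "frac_coord q i = frac (torus_rep q $ i)"

lemma frac_eq_if_diff_Ints:
  fixes x y :: real
  assumes "x - y \<in> \<int>" shows "frac x = frac y"
proof -
  obtain n where "x - y = of_int n" using assms by (auto elim: Ints_cases)
  then have "x = y + of_int n" by simp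
  then show ?thesis by (simp add: frac_def)
qed

lemma frac_coord_torus_proj: "frac_coord (torus_proj z) i = frac (z $ i)"
proof -
  have "torus_proj (torus_rep (torus_proj z)) = torus_proj z" by simp
  then show ?thesis unfolding frac_coord_def torus_proj_eq_iff
    by (intro frac_eq_if_diff_Ints) auto
qed

lemma torus_proj_frac_coord: "torus_proj (\<chi> i. frac_coord q i) = q"
proof -
  have "torus_proj (\<chi> i. frac_coord q i) = torus_proj (torus_rep q)"
    unfolding torus_proj_eq_iff frac_coord_def by (auto simp: frac_def)
  then show ?thesis by simp
qed

lemma compact_torus: "compact (UNIV :: torus set)"
proof -
  have "q \<in> torus_proj ` cbox 0 1" for q
  proof
    show "q = torus_proj (\<chi> i. frac_coord q i)" by (simp add: torus_proj_frac_coord)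
    show "(\<chi> i. frac_coord q i) \<in> cbox 0 1"
      by (auto simp: mem_box_cart frac_coord_def frac_ge_0 less_imp_le[OF frac_lt_1])
  qed
  then have "UNIV = torus_proj ` cbox 0 1" by auto
  then show ?thesis
    using compact_continuous_image[OF continuous_on_torus_proj compact_cbox] by metis
qed

lemma bounded_continuous_torus:
  fixes g :: "torus \<Rightarrow> 'a::real_normed_vector"
  assumes "continuous_on UNIV g"
  obtains B where "\<And>q. norm (g q) \<le> B"
proof -
  have "bounded (range g)"
    by (intro compact_imp_bounded compact_continuous_image assms compact_torus)
  then show thesis using that unfolding bounded_iff by auto
qed

text \<open>The fractional part is lower semicontinuous: it jumps only at integers, where it takes
  its least value 0. So the superlevel sets at levels b >= 0 lift to unions of open strips.\<close>

lemma borel_measurable_frac_coord [measurable]: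
  "(\<lambda>q. frac_coord q i) \<in> borel_measurable borel"
proof (subst borel_measurable_iff_le, intro allI)
  fix b :: real
  show "{q \<in> space borel. frac_coord q i \<le> b} \<in> sets borel"
  proof (cases "0 \<le> b")
    case False
    then have "{q \<in> space borel. frac_coord q i \<le> b} = {}"
      unfolding frac_coord_def using frac_ge_0 order_trans by (auto simp: not_le intro: less_le_trans)
    then show ?thesis by (metis sets.empty_sets)
  next
    case True
    have "torus_proj -` {q. b < frac_coord q i} = (\<Union>n::int. {z. of_int n + b < z $ i \<and> z $ i < of_int n + 1})"
      (is "_ = ?R")
    proof (intro set_eqI iffI)
      fix z assume "z \<in> torus_proj -` {q. b < frac_coord q i}"
      then have "of_int \<lfloor>z $ i\<rfloor> + b < z $ i" by (simp add: frac_coord_torus_proj frac_def)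
      moreover have "z $ i < of_int \<lfloor>z $ i\<rfloor> + 1" by linarith
      ultimately show "z \<in> ?R" by blast
    next
      fix z assume "z \<in> ?R"
      then obtain n :: int where n: "of_int n + b < z $ i" "z $ i < of_int n + 1" by auto
      then have "\<lfloor>z $ i\<rfloor> = n" using True by (intro floor_unique) auto
      then show "z \<in> torus_proj -` {q. b < frac_coord q i}"
        using n by (simp add: frac_coord_torus_proj frac_def)
    qed
    moreover have "open ?R"
      by (intro open_UN ballI open_Collect_conj open_Collect_less continuous_intros)
    ultimately have "open {q. b < frac_coord q i}" by (simp add: open_torus_def)
    then have "closed (- {q. b < frac_coord q i})" by (simp add: closed_def)
    then show ?thesis
      by (rule subst[of "- {q. b < frac_coord q i}" _ "\<lambda>X. X \<in> sets borel", rotated, OF borel_closed]) auto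
  qed
qed

subsection \<open>Schoenberg's curve\<close>

text \<open>Equal to \<open>0\<close> on \<open>[0, 1/3]\<close> and \<open>1\<close> on \<open>[2/3, 1]\<close>, and of period \<open>2\<close>, so that
  \<open>plateau (3 ^ n * t)\<close> reads off the \<open>n\<close>-th digit of a point \<open>t\<close> of the Cantor set.\<close>

definition plateau :: "real \<Rightarrow> real" where
  "plateau t = max 0 (min 1 (1/2 - cos (pi * t)))"

lemma plateau_bounds: "0 \<le> plateau t" "plateau t \<le> 1"
  by (auto simp: plateau_def)

lemma plateau_plus_even: "plateau (2 * real m + x) = plateau x"
proof -
  have "cos (pi * (2 * real m + x)) = cos (pi * x)"
  proof (induction m)
    case (Suc m)
    have "pi * (2 * real (Suc m) + x) = pi * (2 * real m + x) + 2 * pi"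
      by (simp add: algebra_simps)
    then show ?case using Suc by (simp only: cos_periodic)
  qed simp
  then show ?thesis by (simp add: plateau_def)
qed

lemma plateau_low: "plateau x = 0" if "0 \<le> x" "x \<le> 1/3"
proof -
  have "cos (pi / 3) \<le> cos (pi * x)"
    using that by (intro cos_monotone_0_pi_le) (auto simp: mult_left_le_one_le)
  then show ?thesis by (simp add: plateau_def cos_60)
qed

lemma plateau_high: "plateau x = 1" if "2/3 \<le> x" "x \<le> 1"
proof -
  have "cos (pi * x) \<le> cos (pi * (2/3))"
    using that by (intro cos_monotone_0_pi_le) auto
  also have "cos (pi * (2/3)) = - cos (pi / 3)"
    by (simp flip: cos_pi_minus add: algebra_simps)
  finally show ?thesis by (simp add: plateau_def cos_60)
qed

lemma continuous_on_plateau: "continuous_on A plateau"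
  unfolding plateau_def by (intro continuous_intros)

text \<open>For c with values in {0, 1}: the point of the Cantor set whose ternary digits are
  \<open>2 * c k\<close>.\<close>

definition ternary :: "(nat \<Rightarrow> real) \<Rightarrow> real" where
  "ternary c = (\<Sum>k. 2 * c k / 3 ^ Suc k)"

lemma ternary_terms_sums_1: "(\<lambda>k. 2 / 3 ^ Suc k :: real) sums 1"
proof -
  have "(\<lambda>k. (2/3) * (1/3::real) ^ k) sums ((2/3) * (1 / (1 - 1/3)))"
    by (intro sums_mult geometric_sums) auto
  then show ?thesis by (simp add: power_one_over field_simps)
qed

lemma summable_ternary:
  assumes "\<And>k. c k \<in> {0, 1::real}"
  shows "summable (\<lambda>k. 2 * c k / 3 ^ Suc k)"
proof (rule summable_comparison_test'[OF sums_summable[OF ternary_terms_sums_1]])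
  show "norm (2 * c k / 3 ^ Suc k) \<le> 2 / 3 ^ Suc k" for k
    using assms[of k] by auto
qed

lemma ternary_bounds:
  assumes c: "\<And>k. c k \<in> {0, 1::real}"
  shows "0 \<le> ternary c" "ternary c \<le> 1"
proof -
  have c': "0 \<le> c k \<and> c k \<le> 1" for k using c[of k] by auto
  show "0 \<le> ternary c" unfolding ternary_def
    using c' by (intro suminf_nonneg summable_ternary c) auto
  have "ternary c \<le> (\<Sum>k. 2 / 3 ^ Suc k)" unfolding ternary_def
    using c' by (intro suminf_le summable_ternary c sums_summable[OF ternary_terms_sums_1])
      (auto intro: divide_right_mono)
  then show "ternary c \<le> 1" using sums_unique[OF ternary_terms_sums_1] by simp
qed

lemma ternary_shift:
  assumes "\<And>k. c k \<in> {0, 1::real}"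
  shows "ternary c = 2 * c 0 / 3 + ternary (\<lambda>k. c (Suc k)) / 3"
proof -
  have "ternary c = 2 * c 0 / 3 + (\<Sum>k. 2 * c (Suc k) / 3 ^ Suc (Suc k))"
    unfolding ternary_def using suminf_split_head[OF summable_ternary[of c, OF assms]] by simp
  also have "(\<Sum>k. 2 * c (Suc k) / 3 ^ Suc (Suc k)) = (\<Sum>k. (2 * c (Suc k) / 3 ^ Suc k) / 3)"
    by (simp add: field_simps)
  also have "\<dots> = ternary (\<lambda>k. c (Suc k)) / 3"
    unfolding ternary_def by (intro suminf_divide summable_ternary assms)
  finally show ?thesis .
qed

text \<open>Multiplication by 3^n moves digit n to the front. The digits before it, being 0 or 2,
  contribute an even integer, which the period 2 of \<open>plateau\<close> removes; what remains
  lies in [0,1/3] or [2/3,1] according to digit n.\<close>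

lemma plateau_ternary:
  assumes "\<And>k. c k \<in> {0, 1::real}"
  shows "plateau (3 ^ n * ternary c) = c n"
  using assms
proof (induction n arbitrary: c)
  case 0
  note s = ternary_shift[of c, OF 0] ternary_bounds[of "\<lambda>k. c (Suc k)", OF 0]
  from 0[of 0] show ?case
    using s by (auto simp: plateau_low plateau_high)
next
  case (Suc n)
  define m :: nat where "m = (if c 0 = 0 then 0 else 3 ^ n)"
  have "3 ^ Suc n * ternary c = 2 * real m + 3 ^ n * ternary (\<lambda>k. c (Suc k))"
    using Suc.prems[of 0] unfolding ternary_shift[of c, OF Suc.prems]
    by (auto simp: m_def algebra_simps)
  then have "plateau (3 ^ Suc n * ternary c) = plateau (3 ^ n * ternary (\<lambda>k. c (Suc k)))"
    by (simp only: plateau_plus_even)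
  then show ?case using Suc.IH[of "\<lambda>k. c (Suc k)"] Suc.prems by simp
qed

text \<open>The digit of weight 2^-(k+1). Differences of floors telescope and are visibly Borel in
  x.\<close>

definition binary_digit :: "real \<Rightarrow> nat \<Rightarrow> real" where
  "binary_digit x k = of_int \<lfloor>2 ^ Suc k * x\<rfloor> - 2 * of_int \<lfloor>2 ^ k * x\<rfloor>"

lemma binary_digit_01: "binary_digit x k \<in> {0, 1}"
proof -
  define y where "y = 2 ^ k * x"
  have "\<lfloor>2 * y\<rfloor> = 2 * \<lfloor>y\<rfloor> \<or> \<lfloor>2 * y\<rfloor> = 2 * \<lfloor>y\<rfloor> + 1" by linarith
  then show ?thesis by (auto simp: binary_digit_def y_def algebra_simps)
qed

lemma binary_expansion:
  assumes "0 \<le> x" "x < 1"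
  shows "(\<lambda>k. binary_digit x k / 2 ^ Suc k) sums x"
proof -
  \<comment> \<open>Truncation of x to k binary digits: within 2^-k of x, with increments that are
    the terms of the series. It starts at 0 because 0 <= x < 1.\<close>
  define a :: "nat \<Rightarrow> real" where "a k = of_int \<lfloor>2 ^ k * x\<rfloor> / 2 ^ k" for k
  have "(\<lambda>k. x - a k) \<longlonglongrightarrow> 0"
  proof (rule tendsto_sandwich[of "\<lambda>_. 0" _ _ "\<lambda>k. (1/2) ^ k"])
    have "x - a k \<le> (1/2) ^ k \<and> 0 \<le> x - a k" for k
    proof -
      have "x - a k = frac (2 ^ k * x) / 2 ^ k" by (simp add: a_def frac_def field_simps)
      moreover have "0 \<le> frac (2 ^ k * x)" "frac (2 ^ k * x) \<le> 1"
        by (auto simp: frac_ge_0 less_imp_le[OF frac_lt_1])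
      ultimately show ?thesis by (simp add: power_one_over divide_right_mono)
    qed
    then show "\<forall>\<^sub>F k in sequentially. 0 \<le> x - a k" "\<forall>\<^sub>F k in sequentially. x - a k \<le> (1/2) ^ k"
      by (auto intro!: always_eventually)
    show "(\<lambda>k. (1/2::real) ^ k) \<longlonglongrightarrow> 0" by (intro LIMSEQ_realpow_zero) auto
  qed auto
  from tendsto_diff[OF tendsto_const[of x] this] have "a \<longlonglongrightarrow> x" by simp
  then have "(\<lambda>k. a (Suc k) - a k) sums (x - a 0)" by (rule telescope_sums)
  moreover have "a 0 = 0" using assms by (simp add: a_def floor_eq_iff)
  moreover have "a (Suc k) - a k = binary_digit x k / 2 ^ Suc k" for k
    by (simp add: a_def binary_digit_def field_simps)
  ultimately show ?thesis by simp
qed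

text \<open>The curve reads the first coordinate from the ternary digits at even positions and the
  second from those at odd positions.\<close>

definition coord_index :: "2 \<Rightarrow> nat" where
  "coord_index i = (if i = 1 then 0 else 1)"

definition schoenberg :: "real \<Rightarrow> real^2" where
  "schoenberg t = (\<chi> i. \<Sum>k. plateau (3 ^ (2 * k + coord_index i) * t) / 2 ^ Suc k)"

lemma continuous_on_schoenberg: "continuous_on UNIV schoenberg"
proof -
  have "continuous_on UNIV (\<lambda>t. \<Sum>k. plateau (3 ^ (2 * k + coord_index i) * t) / 2 ^ Suc k)" for i
  proof (rule uniform_limit_theorem)
    show "uniform_limit UNIV (\<lambda>n t. \<Sum>k<n. plateau (3 ^ (2 * k + coord_index i) * t) / 2 ^ Suc k)
      (\<lambda>t. \<Sum>k. plateau (3 ^ (2 * k + coord_index i) * t) / 2 ^ Suc k) sequentially"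
    proof (rule Weierstrass_m_test)
      show "norm (plateau (3 ^ (2 * k + coord_index i) * t) / 2 ^ Suc k) \<le> (1/2) ^ Suc k" for k t
        using plateau_bounds[of "3 ^ (2 * k + coord_index i) * t"]
        by (simp add: power_one_over field_simps)
      show "summable (\<lambda>k. (1/2::real) ^ Suc k)" by (simp add: summable_geometric)
    qed
    show "\<forall>\<^sub>F n in sequentially.
        continuous_on UNIV (\<lambda>t. \<Sum>k<n. plateau (3 ^ (2 * k + coord_index i) * t) / 2 ^ Suc k)"
      by (intro always_eventually allI continuous_intros
          continuous_on_compose2[OF continuous_on_plateau[of UNIV]]) auto
  qed simp
  then show ?thesis unfolding schoenberg_def by (intro continuous_on_vec_lambda)
qed

text \<open>Interleaves the binary digits of both coordinates into a point of the Cantor set, from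
  which \<open>schoenberg\<close> recovers the coordinates. No continuous section exists, but floors
  and series make this one Borel, which suffices to push measures forward.\<close>

definition schoenberg_section :: "torus \<Rightarrow> real" where
  "schoenberg_section q = ternary (\<lambda>n. binary_digit (frac_coord q (if even n then 1 else 2)) (n div 2))"

lemma schoenberg_section_bounds: "0 \<le> schoenberg_section q" "schoenberg_section q \<le> 1"
  unfolding schoenberg_section_def by (intro ternary_bounds binary_digit_01)+

lemma schoenberg_schoenberg_section: "torus_proj (schoenberg (schoenberg_section q)) = q"
proof -
  have "schoenberg (schoenberg_section q) $ i = frac_coord q i" for i
  proof -
    have "plateau (3 ^ (2 * k + coord_index i) * schoenberg_section q) = binary_digit (frac_coord q i) k" for k
      unfolding schoenberg_section_def
      by (subst plateau_ternary[OF binary_digit_01]) (use exhaust_2[of i] in \<open>auto simp: coord_index_def\<close>)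
    moreover have "(\<lambda>k. binary_digit (frac_coord q i) k / 2 ^ Suc k) sums frac_coord q i"
      by (intro binary_expansion) (auto simp: frac_coord_def frac_ge_0 frac_lt_1)
    ultimately show ?thesis by (simp add: schoenberg_def sums_iff)
  qed
  then have "schoenberg (schoenberg_section q) = (\<chi> i. frac_coord q i)" by (simp add: vec_eq_iff)
  then show ?thesis by (simp add: torus_proj_frac_coord)
qed

lemma borel_measurable_schoenberg_section [measurable]:
  "schoenberg_section \<in> borel_measurable borel"
  unfolding schoenberg_section_def ternary_def binary_digit_def by measurable

subsection \<open>Compactness of the set of probability measures on the torus\<close>

text \<open>Push the measures to [0,1] by the section, extract a weakly convergent subsequence
  there, and push the limit back by the curve. Continuity matters only for the curve, since test
  functions are composed with it; the section cancels because it is a right inverse.\<close>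

lemma torus_measure_convergent_subseq:
  fixes \<mu> :: "nat \<Rightarrow> torus measure"
  assumes prob: "\<And>k. prob_space (\<mu> k)" and sets: "\<And>k. sets (\<mu> k) = sets borel"
  shows "\<exists>r \<nu>. strict_mono (r :: nat \<Rightarrow> nat) \<and> prob_space \<nu> \<and> sets \<nu> = sets borel \<and>
    (\<forall>h :: torus \<Rightarrow> real. continuous_on UNIV h \<longrightarrow>
       (\<lambda>k. \<integral>q. h q \<partial>\<mu> (r k)) \<longlonglongrightarrow> (\<integral>q. h q \<partial>\<nu>))"
proof -
  note [measurable_cong] = sets
  let ?c = "\<lambda>t. torus_proj (schoenberg t)"
  have c: "continuous_on UNIV ?c"
    by (rule continuous_on_compose2[OF continuous_on_torus_proj continuous_on_schoenberg]) auto
  have c_meas [measurable]: "?c \<in> borel \<rightarrow>\<^sub>M borel"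
    using c by (rule borel_measurable_continuous_onI)
  define \<mu>' where "\<mu>' k = distr (\<mu> k) borel schoenberg_section" for k
  have "tight \<mu>'"
    unfolding tight_def
  proof (intro conjI allI impI)
    show "real_distribution (\<mu>' k)" for k
      unfolding \<mu>'_def by (intro prob_space.real_distribution_distr prob) measurable
    fix \<epsilon> :: real assume "0 < \<epsilon>"
    \<comment> \<open>Tightness asks for half-open intervals; the left end -1 keeps the possible
      value 0 of the section inside.\<close>
    have "measure (\<mu>' k) {-1<..1} = 1" for k
    proof -
      interpret prob_space "\<mu> k" by (rule prob)
      have "- 1 < schoenberg_section q" for q
        using schoenberg_section_bounds(1)[of q] by linarith
      then have "schoenberg_section -` {-1<..1} = UNIV"
        using schoenberg_section_bounds(2) by auto
      moreover have "space (\<mu> k) = UNIV" using sets_eq_imp_space_eq[OF sets[of k]] by simp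
      ultimately show ?thesis
        unfolding \<mu>'_def by (subst measure_distr) (use prob_space in auto)
    qed
    then show "\<exists>a b. a < b \<and> (\<forall>n. 1 - \<epsilon> < measure (\<mu>' n) {a<..b})"
      using \<open>0 < \<epsilon>\<close> by (intro exI[of _ "-1"] exI[of _ 1]) simp
  qed
  from tight_imp_convergent_subsubsequence[OF this strict_mono_id]
  obtain r M where r: "strict_mono r" and M: "real_distribution M" and w: "weak_conv_m (\<mu>' \<circ> r) M"
    by (auto simp: id_def comp_def)
  interpret M: real_distribution M by (rule M)
  define \<nu> where "\<nu> = distr M borel ?c"
  show ?thesis
  proof (intro exI conjI allI impI)
    show "strict_mono r" by (rule r)
    show "prob_space \<nu>" unfolding \<nu>_def by (rule M.prob_space_distr) measurable
    show "sets \<nu> = sets borel" by (simp add: \<nu>_def)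
    fix h :: "torus \<Rightarrow> real" assume h: "continuous_on UNIV h"
    have [measurable]: "h \<in> borel_measurable borel"
      using h by (rule borel_measurable_continuous_onI)
    obtain B where B: "\<And>q. norm (h q) \<le> B" using bounded_continuous_torus[OF h] by blast
    have hc: "continuous_on UNIV (\<lambda>t. h (?c t))"
      by (rule continuous_on_compose2[OF h c]) auto
    have "(\<lambda>n. integral\<^sup>L ((\<mu>' \<circ> r) n) (\<lambda>t. h (?c t))) \<longlonglongrightarrow> integral\<^sup>L M (\<lambda>t. h (?c t))"
    proof (rule weak_conv_imp_integral_bdd_continuous_conv)
      show "real_distribution ((\<mu>' \<circ> r) n)" for n
        unfolding \<mu>'_def comp_def by (intro prob_space.real_distribution_distr prob) measurable
      show "isCont (\<lambda>t. h (?c t)) x" for x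
        using hc by (auto simp: continuous_on_eq_continuous_at)
    qed (use M w B in \<open>auto simp: comp_def\<close>)
    moreover have "integral\<^sup>L ((\<mu>' \<circ> r) n) (\<lambda>t. h (?c t)) = (\<integral>q. h q \<partial>\<mu> (r n))" for n
      unfolding comp_def \<mu>'_def by (subst integral_distr) (auto simp: schoenberg_schoenberg_section)
    moreover have "integral\<^sup>L M (\<lambda>t. h (?c t)) = (\<integral>q. h q \<partial>\<nu>)"
      unfolding \<nu>_def by (subst integral_distr) auto
    ultimately show "(\<lambda>k. \<integral>q. h q \<partial>\<mu> (r k)) \<longlonglongrightarrow> (\<integral>q. h q \<partial>\<nu>)" by simp
  qed
qed

text \<open>The distance in the plane to the complement of the preimage of U is invariant under the
  lattice, so it descends to a continuous function on the torus that is positive exactly on U; its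
  multiples, cut off at 1, increase to the indicator.\<close>

lemma open_torus_indicator_limit:
  assumes "open (U :: torus set)"
  obtains h :: "nat \<Rightarrow> torus \<Rightarrow> real" where "\<And>n. continuous_on UNIV (h n)"
    "\<And>n q. 0 \<le> h n q \<and> h n q \<le> 1" "\<And>q. (\<lambda>n. h n q) \<longlonglongrightarrow> indicator U q"
proof (cases "U = UNIV")
  \<comment> \<open>\<open>infdist\<close> to the empty set is 0 by convention, so the construction
    below would give 0 instead of 1.\<close>
  case True
  show thesis by (rule that[of "\<lambda>_ _. 1"]) (auto simp: True)
next
  case False
  define C where "C = - (torus_proj -` U)"
  have cl: "closed C" using assms by (simp add: C_def open_torus_def closed_def)
  have ne: "C \<noteq> {}"
  proof
    assume "C = {}"
    then have "torus_rep q \<in> torus_proj -` U" for q unfolding C_def by blast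
    then have "q \<in> U" for q by simp
    then show False using False by blast
  qed
  \<comment> \<open>Translation by the lattice vector x - y preserves C and takes y to x.\<close>
  have le: "infdist x C \<le> infdist y C" if "torus_proj x = torus_proj y" for x y
  proof -
    have "infdist x C \<le> dist y c" if "c \<in> C" for c
    proof -
      have "torus_proj (c + (x - y)) = torus_proj c"
        using \<open>torus_proj x = torus_proj y\<close> by (simp add: torus_proj_eq_iff)
      then have "c + (x - y) \<in> C" using \<open>c \<in> C\<close> by (simp add: C_def)
      then have "infdist x C \<le> dist x (c + (x - y))" by (rule infdist_le)
      also have "\<dots> = dist y c" by (simp add: dist_norm algebra_simps)
      finally show ?thesis .
    qed
    then show ?thesis unfolding infdist_notempty[OF ne, of y] by (intro cINF_greatest ne) auto
  qed
  have eq: "infdist (torus_rep (torus_proj z)) C = infdist z C" for z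
    by (intro antisym le) simp_all
  define h where "h n q = min 1 (real n * infdist (torus_rep q) C)" for n q
  show thesis
  proof (rule that[of h])
    show "continuous_on UNIV (h n)" for n
      unfolding h_def by (intro continuous_on_torusI) (simp only: eq, intro continuous_intros)
    show "0 \<le> h n q \<and> h n q \<le> 1" for n q by (simp add: h_def infdist_nonneg)
    show "(\<lambda>n. h n q) \<longlonglongrightarrow> indicator U q" for q
    proof (cases "q \<in> U")
      case True
      then have "torus_rep q \<notin> C" by (simp add: C_def)
      then have pos: "infdist (torus_rep q) C > 0"
        using in_closed_iff_infdist_zero[OF cl ne] infdist_nonneg[of "torus_rep q" C] by fastforce
      obtain N where N: "1 < real N * infdist (torus_rep q) C"
        using reals_Archimedean3[OF pos] by blast
      have "h n q = 1" if "n \<ge> N" for n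
      proof -
        have "real N * infdist (torus_rep q) C \<le> real n * infdist (torus_rep q) C"
          using that pos by (intro mult_right_mono) auto
        then show ?thesis using N by (simp add: h_def)
      qed
      then have "\<forall>\<^sub>F n in sequentially. h n q = 1" by (auto simp: eventually_sequentially)
      then show ?thesis using True by (simp add: tendsto_eventually)
    next
      case False
      then have "torus_rep q \<in> C" by (simp add: C_def)
      then show ?thesis using False by (simp add: h_def)
    qed
  qed
qed

text \<open>Open sets form an intersection-stable generator of the Borel sets, and their measures
  are limits of integrals of continuous functions.\<close>

lemma torus_measure_eqI:
  fixes \<mu> \<nu> :: "torus measure"
  assumes \<mu>: "prob_space \<mu>" "sets \<mu> = sets borel" and \<nu>: "prob_space \<nu>" "sets \<nu> = sets borel"
    and eq: "\<And>h :: torus \<Rightarrow> real. continuous_on UNIV h \<Longrightarrow> (\<integral>q. h q \<partial>\<mu>) = (\<integral>q. h q \<partial>\<nu>)"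
  shows "\<mu> = \<nu>"
proof (rule measure_eqI_generator_eq[where E = "{U. open U}" and \<Omega> = UNIV and A = "\<lambda>_. UNIV"])
  interpret \<mu>: prob_space \<mu> by fact
  interpret \<nu>: prob_space \<nu> by fact
  have [simp]: "space \<mu> = UNIV" "space \<nu> = UNIV"
    using \<mu>(2) \<nu>(2) by (auto dest: sets_eq_imp_space_eq)
  show "Int_stable {U :: torus set. open U}" by (auto simp: Int_stable_def)
  show "sets \<mu> = sigma_sets UNIV {U. open U}" "sets \<nu> = sigma_sets UNIV {U. open U}"
    using \<mu>(2) \<nu>(2) by (auto simp: borel_def)
  show "emeasure \<mu> UNIV \<noteq> \<infinity>" by simp
  fix U :: "torus set" assume "U \<in> {U. open U}"
  then have U: "open U" by simp
  then have [measurable]: "U \<in> sets borel" by simp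
  obtain h :: "nat \<Rightarrow> torus \<Rightarrow> real" where h: "\<And>n. continuous_on UNIV (h n)"
    "\<And>n q. 0 \<le> h n q \<and> h n q \<le> 1" "\<And>q. (\<lambda>n. h n q) \<longlonglongrightarrow> indicator U q"
    using open_torus_indicator_limit[OF U] by blast
  have [measurable]: "h n \<in> borel_measurable borel" for n
    using h(1) by (rule borel_measurable_continuous_onI)
  have lim: "(\<lambda>n. \<integral>q. h n q \<partial>M) \<longlonglongrightarrow> measure M U"
    if "prob_space M" and [measurable_cong]: "sets M = sets borel" for M :: "torus measure"
  proof -
    interpret M: prob_space M by fact
    have "(\<lambda>n. \<integral>q. h n q \<partial>M) \<longlonglongrightarrow> (\<integral>q. indicator U q \<partial>M)"
      by (rule integral_dominated_convergence[where w = "\<lambda>_. 1"]) (use h in auto)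
    moreover have "U \<inter> space M = U" using sets_eq_imp_space_eq[OF that(2)] by simp
    ultimately show ?thesis by simp
  qed
  have "measure \<mu> U = measure \<nu> U"
    using lim[OF \<mu>] lim[OF \<nu>] unfolding eq[OF h(1)] by (rule LIMSEQ_unique)
  then show "emeasure \<mu> U = emeasure \<nu> U"
    by (simp add: \<mu>.emeasure_eq_measure \<nu>.emeasure_eq_measure)
qed auto

lemma invariant_measures_integral_comp:
  fixes h :: "'a :: topological_space \<Rightarrow> 'b :: {banach, second_countable_topology}"
  assumes \<mu>: "\<mu> \<in> invariant_measures f"
    and f: "f \<in> borel \<rightarrow>\<^sub>M borel" and h: "h \<in> borel_measurable borel"
  shows "(\<integral>q. h (f q) \<partial>\<mu>) = (\<integral>q. h q \<partial>\<mu>)"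
proof -
  have [measurable_cong]: "sets \<mu> = sets borel" and d: "distr \<mu> borel f = \<mu>"
    using \<mu> by (auto simp: invariant_measures_def)
  note [measurable] = f h
  show ?thesis by (subst (2) d[symmetric], subst integral_distr) auto
qed

text \<open>A weak limit of a maximizing sequence attains the supremum. It is again invariant
  because \<open>g \<circ> f\<close> is a continuous test function whenever g is, so that the
  equality of integrals passes to the limit.\<close>

lemma ex_maximizing_invariant_measure:
  fixes h :: "torus \<Rightarrow> real"
  assumes f: "continuous_on UNIV f" and h: "continuous_on UNIV h"
    and ne: "invariant_measures f \<noteq> {}"
  obtains \<mu> where "\<mu> \<in> invariant_measures f"
    "\<And>\<nu>. \<nu> \<in> invariant_measures f \<Longrightarrow> (\<integral>q. h q \<partial>\<nu>) \<le> (\<integral>q. h q \<partial>\<mu>)"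
proof -
  have f_meas [measurable]: "f \<in> borel \<rightarrow>\<^sub>M borel" using f by (rule borel_measurable_continuous_onI)
  have [measurable]: "h \<in> borel_measurable borel" using h by (rule borel_measurable_continuous_onI)
  obtain B where B: "\<And>q. norm (h q) \<le> B" using bounded_continuous_torus[OF h] by blast
  let ?I = "(\<lambda>\<mu>. \<integral>q. h q \<partial>\<mu>) ` invariant_measures f"
  have "(\<integral>q. h q \<partial>\<mu>) \<le> B" if "\<mu> \<in> invariant_measures f" for \<mu>
  proof -
    interpret prob_space \<mu> using that by (simp add: invariant_measures_def)
    have [measurable_cong]: "sets \<mu> = sets borel" using that by (simp add: invariant_measures_def)
    have "integrable \<mu> h" by (rule integrable_const_bound[where B = B]) (use B in auto)
    then show ?thesis by (rule integral_le_const) (use B in \<open>auto intro: abs_le_D1\<close>)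
  qed
  then have bdd: "bdd_above ?I" by (rule bdd_aboveI2)
  have "Sup ?I \<in> closure ?I" using ne bdd by (intro closure_contains_Sup) auto
  then obtain x where x: "\<And>k. x k \<in> ?I" "x \<longlonglongrightarrow> Sup ?I"
    unfolding closure_sequential by blast
  then have "\<forall>k. \<exists>\<mu>\<in>invariant_measures f. x k = (\<integral>q. h q \<partial>\<mu>)" by blast
  then obtain \<mu> where \<mu>: "\<And>k. \<mu> k \<in> invariant_measures f" "\<And>k. x k = (\<integral>q. h q \<partial>\<mu> k)"
    by metis
  obtain r \<nu> where r: "strict_mono (r :: nat \<Rightarrow> nat)" and \<nu>: "prob_space \<nu>" "sets \<nu> = sets borel"
    and lim: "\<And>h :: torus \<Rightarrow> real. continuous_on UNIV h \<Longrightarrow>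
       (\<lambda>k. \<integral>q. h q \<partial>\<mu> (r k)) \<longlonglongrightarrow> (\<integral>q. h q \<partial>\<nu>)"
    using torus_measure_convergent_subseq[of \<mu>] \<mu>(1) unfolding invariant_measures_def by blast
  note [measurable_cong] = \<nu>(2)
  have "distr \<nu> borel f = \<nu>"
  proof (rule torus_measure_eqI[OF _ _ \<nu>])
    show "prob_space (distr \<nu> borel f)" by (rule prob_space.prob_space_distr[OF \<nu>(1)]) measurable
    fix g :: "torus \<Rightarrow> real" assume g: "continuous_on UNIV g"
    then have [measurable]: "g \<in> borel_measurable borel" by (rule borel_measurable_continuous_onI)
    have "(\<lambda>k. \<integral>q. g (f q) \<partial>\<mu> (r k)) \<longlonglongrightarrow> (\<integral>q. g (f q) \<partial>\<nu>)"
      by (intro lim continuous_on_compose2[OF g f]) auto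
    moreover have "(\<integral>q. g (f q) \<partial>\<mu> (r k)) = (\<integral>q. g q \<partial>\<mu> (r k))" for k
      by (intro invariant_measures_integral_comp[OF \<mu>(1)]) measurable
    ultimately have "(\<integral>q. g (f q) \<partial>\<nu>) = (\<integral>q. g q \<partial>\<nu>)"
      using LIMSEQ_unique[OF lim[OF g]] by simp
    then show "(\<integral>q. g q \<partial>distr \<nu> borel f) = (\<integral>q. g q \<partial>\<nu>)"
      by (subst integral_distr) auto
  qed simp
  then have "\<nu> \<in> invariant_measures f" using \<nu> by (simp add: invariant_measures_def)
  moreover have "(\<lambda>k. x (r k)) \<longlonglongrightarrow> (\<integral>q. h q \<partial>\<nu>)" using lim[OF h] by (simp add: \<mu>(2))
  then have "(\<integral>q. h q \<partial>\<nu>) = Sup ?I"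
    using LIMSEQ_subseq_LIMSEQ[OF x(2) r] unfolding comp_def by (rule LIMSEQ_unique)
  ultimately show thesis
    using cSup_upper[OF _ bdd] by (intro that[of \<nu>]) auto
qed

text \<open>Outside the support every point has an open null neighbourhood. Lindelof's theorem,
  applied to the preimages in the plane, extracts a countable cover, and a countable union of null
  sets is null.\<close>

lemma emeasure_torus_Compl_supp_subset:
  fixes \<mu> :: "torus measure"
  assumes \<mu>: "sets \<mu> = sets borel" and sub: "supp \<mu> \<subseteq> X" and X: "closed X"
  shows "emeasure \<mu> (- X) = 0"
proof -
  let ?N = "{U. open U \<and> emeasure \<mu> U = 0}"
  obtain \<U> where \<U>: "\<U> \<subseteq> (\<lambda>U. torus_proj -` U) ` ?N" "countable \<U>"
    "\<Union>\<U> = \<Union>((\<lambda>U. torus_proj -` U) ` ?N)"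
    by (rule Lindelof[of "(\<lambda>U. torus_proj -` U) ` ?N"]) (auto simp: open_torus_def)
  obtain \<V> where \<V>: "\<V> \<subseteq> ?N" "countable \<V>" "\<U> = (\<lambda>U. torus_proj -` U) ` \<V>"
    using countable_subset_image[of \<U> "\<lambda>U. torus_proj -` U" ?N] \<U> by auto
  have "- X \<subseteq> \<Union>\<V>"
  proof
    fix q assume "q \<in> - X"
    then have "q \<notin> supp \<mu>" using sub by blast
    then obtain U where "U \<in> ?N" "q \<in> U" by (auto simp: supp_def)
    then have "torus_rep q \<in> \<Union>((\<lambda>U. torus_proj -` U) ` ?N)" by (auto intro!: exI[of _ U])
    then have "torus_rep q \<in> \<Union>\<U>" by (simp only: \<U>(3))
    then show "q \<in> \<Union>\<V>" by (auto simp: \<V>(3))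
  qed
  moreover have "(\<Union>\<V>) \<in> null_sets \<mu>"
  proof -
    have "(\<Union>V\<in>\<V>. V) \<in> null_sets \<mu>"
      using \<V> \<mu> by (intro null_sets_UN' \<V>(2)) (auto simp: null_sets_def)
    then show ?thesis by simp
  qed
  moreover have "- X \<in> sets \<mu>" using X \<mu> by auto
  ultimately show ?thesis using null_sets_subset by blast
qed

subsection \<open>Lifts of maps isotopic to the identity\<close>

text \<open>The i-th coordinate character, independent of the chosen representative. It sends loops
  on the torus to loops in the punctured plane, where winding numbers around 0 count turns in
  coordinate i.\<close>

definition torus_char :: "2 \<Rightarrow> torus \<Rightarrow> complex" where
  "torus_char i q = exp (2 * of_real pi * \<i> * of_real (torus_rep q $ i))"

lemma torus_char_torus_proj:
  "torus_char i (torus_proj z) = exp (2 * of_real pi * \<i> * of_real (z $ i))"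
proof -
  have "torus_proj (torus_rep (torus_proj z)) = torus_proj z" by simp
  then have "torus_rep (torus_proj z) $ i - z $ i \<in> \<int>" unfolding torus_proj_eq_iff by blast
  then obtain n where n: "torus_rep (torus_proj z) $ i - z $ i = of_int n"
    by (auto elim: Ints_cases)
  then have "torus_rep (torus_proj z) $ i = z $ i + of_int n" by simp
  then show ?thesis unfolding torus_char_def exp_eq
    by (intro exI[of _ n]) (simp add: algebra_simps)
qed

lemma continuous_on_torus_char: "continuous_on UNIV (torus_char i)"
  by (intro continuous_on_torusI) (simp add: torus_char_torus_proj, intro continuous_intros)

text \<open>The curve is the exponential of the path 2 pi i G_i, so its winding number is the
  increment of that path divided by 2 pi i.\<close>

lemma winding_number_lift:
  fixes G :: "real^2 \<Rightarrow> real^2"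
  assumes "continuous_on UNIV G"
  shows "winding_number (\<lambda>s. torus_char i (torus_proj (G (z + s *\<^sub>R m)))) 0
    = of_real (G (z + m) $ i - G z $ i)"
proof -
  let ?p = "\<lambda>s. 2 * of_real pi * \<i> * of_real (G (z + s *\<^sub>R m) $ i) :: complex"
  have "continuous_on {0..1} (\<lambda>s. G (z + s *\<^sub>R m))"
    by (rule continuous_on_compose2[OF assms]) (auto intro!: continuous_intros)
  then have "path ?p" unfolding path_def by (intro continuous_intros)
  from winding_number_compose_exp[OF this] show ?thesis
    by (simp add: comp_def torus_char_torus_proj pathfinish_def pathstart_def diff_divide_distrib)
qed

text \<open>The isotopy makes the projected segment from \<open>z\<close> to \<open>z + m\<close> freely homotopic, as a loop
  in the torus, to its image under \<open>f\<close>, so their coordinates have the same winding numbers.\<close>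

lemma isotopic_to_id_lift_translation:
  assumes iso: "isotopic_to_id f" and lift: "is_lift F f" and m: "\<And>i. m $ i \<in> \<int>"
  shows "F (z + m) = F z + m"
proof -
  obtain h where h: "continuous_on ({0..1::real} \<times> UNIV) h"
    and h0: "\<And>q. h (0, q) = q" and h1: "\<And>q. h (1, q) = f q"
    using iso unfolding isotopic_to_id_def homotopic_with_def prod_topology_subtopology_eu by auto
  have F: "continuous_on UNIV F" and Ff: "\<And>z. torus_proj (F z) = f (torus_proj z)"
    using lift by (auto simp: is_lift_def)
  have "F (z + m) $ i - F z $ i = m $ i" for i
  proof -
    let ?k = "\<lambda>y. torus_char i (h (fst y, torus_proj (z + snd y *\<^sub>R m)))"
    have "continuous_on ({0..1} \<times> {0..1}) (\<lambda>y. torus_proj (z + snd y *\<^sub>R m))"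
      by (rule continuous_on_compose2[OF continuous_on_torus_proj[of UNIV]])
        (auto intro!: continuous_intros)
    then have "continuous_on ({0..1} \<times> {0..1}) (\<lambda>y. (fst y, torus_proj (z + snd y *\<^sub>R m)))"
      by (intro continuous_intros)
    then have "continuous_on ({0..1} \<times> {0..1}) (\<lambda>y. h (fst y, torus_proj (z + snd y *\<^sub>R m)))"
      by (rule continuous_on_compose2[OF h]) auto
    then have "continuous_on ({0..1} \<times> {0..1}) ?k"
      by (rule continuous_on_compose2[OF continuous_on_torus_char]) auto
    \<comment> \<open>Integrality of m closes the segment up on the torus, so every stage of the
      isotopy gives a loop.\<close>
    moreover have "torus_proj (z + m) = torus_proj z" using m by (simp add: torus_proj_eq_iff)
    ultimately have "homotopic_loops (- {0})
        (\<lambda>s. torus_char i (torus_proj (z + s *\<^sub>R m)))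
        (\<lambda>s. torus_char i (torus_proj (F (z + s *\<^sub>R m))))"
      unfolding homotopic_loops
      by (intro exI[of _ ?k])
        (auto simp: h0 h1 Ff torus_char_def pathfinish_def pathstart_def)
    \<comment> \<open>Only the two ends of the homotopy are lifted: by the identity at time 0, by F
      at time 1.\<close>
    then have "of_real ((z + m) $ i - z $ i) = (of_real (F (z + m) $ i - F z $ i) :: complex)"
      using winding_number_lift[OF continuous_on_id, of i z m]
        winding_number_lift[OF F, of i z m] winding_number_homotopic_loops by metis
    then show ?thesis unfolding of_real_eq_iff by simp
  qed
  then show ?thesis by (simp add: vec_eq_iff algebra_simps)
qed

subsection \<open>Birkhoff sums bounded from above\<close>

lemma birkhoff_sum_bounded_AE:
  fixes g :: "'a :: topological_space \<Rightarrow> real"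
  assumes \<mu>: "\<mu> \<in> invariant_measures f"
    and f [measurable]: "f \<in> borel \<rightarrow>\<^sub>M borel" and g [measurable]: "g \<in> borel_measurable borel"
    and int: "integrable \<mu> g" and zero: "(\<integral>q. g q \<partial>\<mu>) = 0"
    and upper: "\<And>n q. (\<Sum>i<n. g ((f ^^ i) q)) \<le> C"
  shows "AE q in \<mu>. \<forall>n. \<bar>\<Sum>i<n. g ((f ^^ i) q)\<bar> \<le> C"
proof -
  have sets [measurable_cong]: "sets \<mu> = sets borel" and d: "distr \<mu> borel f = \<mu>"
    using \<mu> by (auto simp: invariant_measures_def)
  interpret prob_space \<mu> using \<mu> by (simp add: invariant_measures_def)
  have [measurable]: "f ^^ i \<in> borel \<rightarrow>\<^sub>M borel" for i
    by (induction i) (auto intro: measurable_comp[OF _ f])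
  define S where "S n q = (\<Sum>i<n. g ((f ^^ i) q))" for n q
  define u where "u q = (SUP n. S n q)" for q
  have S0: "S 0 q = 0" for q by (simp add: S_def)
  have S_Suc: "S (Suc n) q = g q + S n (f q)" for n q
    unfolding S_def by (subst sum.lessThan_Suc_shift) (simp add: funpow_swap1)
  have S_le: "S n q \<le> C" for n q unfolding S_def by (rule upper)
  have bdd: "bdd_above (range (\<lambda>n. S n q))" for q using S_le by (rule bdd_aboveI2)
  have S_le_u: "S n q \<le> u q" for n q unfolding u_def by (rule cSUP_upper[OF UNIV_I bdd])
  have [measurable]: "S n \<in> borel_measurable borel" for n unfolding S_def by measurable
  have u_meas [measurable]: "u \<in> borel_measurable borel"
    unfolding u_def by (rule borel_measurable_cSUP) (auto simp: bdd)
  \<comment> \<open>The supremum includes n = 0, whose empty sum is 0; this gives u >= 0.\<close>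
  have u_bounds: "0 \<le> u q" "u q \<le> C" for q
    using S_le_u[of 0 q] S0 S_le by (auto simp: u_def intro: cSUP_least)
  define h where "h q = u q - u (f q) - g q" for q
  \<comment> \<open>Sums started at \<open>f q\<close> are, after adding \<open>g q\<close>, sums
    started at q with one more term, hence at most \<open>u q\<close>.\<close>
  have h_nonneg: "0 \<le> h q" for q
  proof -
    have "S n (f q) \<le> u q - g q" for n
      using S_le_u[of "Suc n" q] by (simp add: S_Suc)
    then have "u (f q) \<le> u q - g q" unfolding u_def[of "f q"] by (intro cSUP_least) auto
    then show ?thesis by (simp add: h_def)
  qed
  have int_u: "integrable \<mu> u" "integrable \<mu> (\<lambda>q. u (f q))"
    by (rule integrable_const_bound[where B = C]; use u_bounds in auto)+
  have int_h: "integrable \<mu> h" unfolding h_def using int_u int by simp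
  have "(\<integral>q. h q \<partial>\<mu>) = 0"
    unfolding h_def using int_u int zero invariant_measures_integral_comp[OF \<mu> f u_meas] by simp
  then have "AE q in \<mu>. h q = 0"
    using integral_nonneg_eq_0_iff_AE[OF int_h] h_nonneg by simp
  \<comment> \<open>By invariance, preimages of \<mu>-null sets under f are null, so the vanishing
    of h spreads to every time i.\<close>
  have "AE q in \<mu>. h ((f ^^ i) q) = 0" for i
  proof (induction i)
    case (Suc i)
    then have "AE q in distr \<mu> borel f. h ((f ^^ i) q) = 0" by (simp only: d)
    then have "AE q in \<mu>. h ((f ^^ i) (f q)) = 0"
      by (subst (asm) AE_distr_iff) (auto simp: h_def)
    then show ?case by (simp add: funpow_swap1)
  qed (use \<open>AE q in \<mu>. h q = 0\<close> in simp)
  then have "AE q in \<mu>. \<forall>i. h ((f ^^ i) q) = 0" by (simp add: AE_all_countable)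
  then show ?thesis
  proof (rule AE_mp, intro AE_I2 impI allI)
    fix q n assume h0: "\<forall>i. h ((f ^^ i) q) = 0"
    \<comment> \<open>With h zero along the orbit, g is the difference of consecutive values of u,
      and the sum telescopes to a difference of two numbers in [0, C].\<close>
    have "S n q = u q - u ((f ^^ n) q)"
    proof (induction n)
      case (Suc n)
      have "h ((f ^^ n) q) = 0" using h0 by simp
      then show ?case using Suc by (simp add: S_def h_def)
    qed (simp add: S0)
    then have "\<bar>S n q\<bar> \<le> C" using u_bounds[of q] u_bounds[of "(f ^^ n) q"] by linarith
    then show "\<bar>\<Sum>i<n. g ((f ^^ i) q)\<bar> \<le> C" by (simp add: S_def)
  qed
qed

lemma AE_closed_imp_supp_subset:
  fixes \<mu> :: "'a :: topological_space measure"
  assumes \<mu>: "sets \<mu> = sets borel" and E: "closed E" and AE: "AE q in \<mu>. q \<in> E"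
  shows "supp \<mu> \<subseteq> E"
proof
  fix x assume x: "x \<in> supp \<mu>"
  show "x \<in> E"
  proof (rule ccontr)
    assume "x \<notin> E"
    then have "emeasure \<mu> (- E) > 0" using x E by (auto simp: supp_def closed_def)
    moreover have "- E \<in> sets \<mu>" using E \<mu> by auto
    then have "emeasure \<mu> (- E) = 0"
      using AE AE_iff_measurable[of "- E" \<mu> "\<lambda>q. q \<in> E"] sets_eq_imp_space_eq[OF \<mu>] by auto
    ultimately show False by simp
  qed
qed

lemma AE_in_closed_superset_of_supp:
  fixes \<mu> :: "torus measure"
  assumes \<mu>: "sets \<mu> = sets borel" and sub: "supp \<mu> \<subseteq> X" and X: "closed X"
  shows "AE q in \<mu>. q \<in> X"
proof -
  have "- X \<in> sets \<mu>" using X \<mu> by auto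
  then show ?thesis
    using emeasure_torus_Compl_supp_subset[OF assms]
    by (subst AE_iff_measurable[of "- X"]) (auto simp: sets_eq_imp_space_eq[OF \<mu>])
qed

theorem proposition5:
  fixes f :: "torus \<Rightarrow> torus"
    and F :: "real^2 \<Rightarrow> real^2"
    and \<psi> :: "real^2 \<Rightarrow> real"
    and L :: real
  assumes "homeo f"
    and "isotopic_to_id f"
    and "is_lift F f"
    and "interior (rotation_set f F) \<noteq> {}"
    and "\<And>z n. n \<ge> 1 \<Longrightarrow>
      infdist ((F ^^ n) z - z) ((\<lambda>v. real n *\<^sub>R v) ` rotation_set f F) \<le> L"
    and "linear \<psi>"
    and "\<psi> \<noteq> (\<lambda>_. 0)"
  shows "(\<forall>\<mu>\<in>invariant_measures f.
           supp \<mu> \<subseteq> maximizing_set f F \<psi> \<longrightarrow> \<mu> \<in> maximizing_measures f F \<psi>) \<and>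
         (\<forall>z. torus_proj z \<in> maximizing_set f F \<psi> \<longrightarrow>
           (\<forall>n\<ge>1. \<bar>\<psi> ((F ^^ n) z) - \<psi> z - real n * max_rot f F \<psi>\<bar> \<le> L * onorm \<psi>))"
proof -

  \<comment> \<open>Periodicity and integrals of the displacement\<close>
  have F: "continuous_on UNIV F" and Ff: "\<And>z. torus_proj (F z) = f (torus_proj z)"
    using \<open>is_lift F f\<close> by (auto simp: is_lift_def)
  have f: "continuous_on UNIV f"
    using \<open>homeo f\<close> by (auto simp: homeo_def homeomorphism_def)
  have f_meas [measurable]: "f \<in> borel \<rightarrow>\<^sub>M borel" using f by (rule borel_measurable_continuous_onI)
  have bl: "bounded_linear \<psi>" using \<open>linear \<psi>\<close> by (rule linear_conv_bounded_linear[THEN iffD1])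
  note lin = linear_add[OF \<open>linear \<psi>\<close>] linear_diff[OF \<open>linear \<psi>\<close>] linear_cmul[OF \<open>linear \<psi>\<close>]

  \<comment> \<open>The definite description has a value only for periodic F - Id. Here the isotopy
    enters: F commutes with the translation by the lattice vector x - y.\<close>
  have disp: "displacement F (torus_proj z) = F z - z" for z
  proof (rule displacement_torus_proj)
    fix x y assume "torus_proj x = torus_proj y"
    then have "F (y + (x - y)) = F y + (x - y)"
      by (intro isotopic_to_id_lift_translation[OF \<open>isotopic_to_id f\<close> \<open>is_lift F f\<close>])
        (auto simp: torus_proj_eq_iff)
    then show "F x - x = F y - y" by (simp add: algebra_simps)
  qed
  have D: "continuous_on UNIV (displacement F)"
    by (intro continuous_on_torusI) (simp only: disp, intro continuous_intros F)
  have D_meas [measurable]: "displacement F \<in> borel_measurable borel"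
    using D by (rule borel_measurable_continuous_onI)
  define \<phi> where "\<phi> q = \<psi> (displacement F q)" for q
  have \<phi>: "continuous_on UNIV \<phi>" unfolding \<phi>_def
    by (rule bounded_linear.continuous_on[OF bl D])
  have [measurable]: "\<phi> \<in> borel_measurable borel" using \<phi> by (rule borel_measurable_continuous_onI)
  obtain B where B: "\<And>q. norm (displacement F q) \<le> B" using bounded_continuous_torus[OF D] by blast
  have int_D: "integrable \<mu> (displacement F)" if "\<mu> \<in> invariant_measures f" for \<mu>
  proof -
    have p: "prob_space \<mu>" and s [measurable_cong]: "sets \<mu> = sets borel"
      using that by (auto simp: invariant_measures_def)
    interpret prob_space \<mu> by (rule p)
    show ?thesis by (rule integrable_const_bound[where B = B]) (use B in auto)
  qed
  have rot: "\<psi> (rot F \<mu>) = (\<integral>q. \<phi> q \<partial>\<mu>)" and int_\<phi>: "integrable \<mu> \<phi>"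
    if "\<mu> \<in> invariant_measures f" for \<mu>
    unfolding rot_def \<phi>_def
    using integral_bounded_linear[OF bl int_D[OF that]] integrable_bounded_linear[OF bl int_D[OF that]]
    by simp_all

  \<comment> \<open>Attainment of the maximum\<close>
  have ne: "rotation_set f F \<noteq> {}" using assms(4) by auto
  then have "invariant_measures f \<noteq> {}" by (simp add: rotation_set_def)
  then obtain \<mu>0 where \<mu>0: "\<mu>0 \<in> invariant_measures f"
    "\<And>\<nu>. \<nu> \<in> invariant_measures f \<Longrightarrow> (\<integral>q. \<phi> q \<partial>\<nu>) \<le> (\<integral>q. \<phi> q \<partial>\<mu>0)"
    using ex_maximizing_invariant_measure[OF f \<phi>] by blast
  define \<alpha> where "\<alpha> = max_rot f F \<psi>"
  have "\<alpha> = \<psi> (rot F \<mu>0)"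
    unfolding \<alpha>_def max_rot_def by (rule Greatest_equality) (use \<mu>0 rot in auto)
  then have \<alpha>: "\<psi> (rot F \<mu>) \<le> \<alpha>" if "\<mu> \<in> invariant_measures f" for \<mu>
    using that \<mu>0 rot by auto

  \<comment> \<open>Birkhoff sums of the normalized displacement and their upper bound\<close>
  define C where "C = L * onorm \<psi>"
  define g where "g q = \<phi> q - \<alpha>" for q
  define S where "S n q = (\<Sum>i<n. g ((f ^^ i) q))" for n q
  have g: "continuous_on UNIV g" unfolding g_def by (intro continuous_intros \<phi>)
  have [measurable]: "g \<in> borel_measurable borel" using g by (rule borel_measurable_continuous_onI)
  have f_pow: "continuous_on UNIV (f ^^ i)" for i
    by (induction i) (auto intro: continuous_on_compose2[OF f] simp: comp_def id_def)
  have S_cont: "continuous_on UNIV (S n)" for n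
    unfolding S_def by (intro continuous_intros continuous_on_compose2[OF g f_pow]) auto
  have Fn: "torus_proj ((F ^^ n) z) = (f ^^ n) (torus_proj z)" for n z
    by (induction n) (auto simp: Ff)
  \<comment> \<open>Consecutive displacements along a lifted orbit telescope.\<close>
  have S_proj: "S n (torus_proj z) = \<psi> ((F ^^ n) z) - \<psi> z - real n * \<alpha>" for n z
  proof (induction n)
    case (Suc n)
    have "g ((f ^^ n) (torus_proj z)) = \<psi> (F ((F ^^ n) z)) - \<psi> ((F ^^ n) z) - \<alpha>"
      by (simp add: g_def \<phi>_def disp lin flip: Fn)
    then show ?case using Suc by (simp add: S_def algebra_simps)
  qed (simp add: S_def)

  \<comment> \<open>A distance is nonnegative, so one instance (n = 1, z = 0) of the bound suffices;
    C >= 0 then settles the empty sum n = 0.\<close>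
  have "0 \<le> L" using assms(5)[of 1 0] infdist_nonneg order_trans by blast
  then have "0 \<le> C" by (simp add: C_def onorm_pos_le[OF bl])
  have S_le: "S n q \<le> C" for n q
  proof (cases "n \<ge> 1")
    case False
    then have "n = 0" by simp
    then show ?thesis using \<open>0 \<le> C\<close> by (simp add: S_def)
  next
    case True
    define z where "z = torus_rep q"
    let ?A = "(\<lambda>v. real n *\<^sub>R v) ` rotation_set f F"
    \<comment> \<open>Since the rotation set is nonempty, \<open>infdist\<close> is a true infimum,
      and some a in \<open>?A\<close> lies within L + \<epsilon>. There \<psi> is at most n
      \<alpha>, and the deviation from a costs at most the operator norm times L + \<epsilon>;
      afterwards \<epsilon> tends to 0.\<close>
    have "(\<psi> ((F ^^ n) z - z) - real n * \<alpha>) \<le> C + onorm \<psi> * \<epsilon>" if "0 < \<epsilon>" for \<epsilon>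
    proof -
      have "infdist ((F ^^ n) z - z) ?A < L + \<epsilon>" using assms(5)[OF True, of z] that by linarith
      then obtain a where "a \<in> ?A" and a: "dist ((F ^^ n) z - z) a < L + \<epsilon>"
        using ne by (subst (asm) infdist_notempty) (auto simp: cINF_less_iff)
      then obtain \<mu> where \<mu>: "\<mu> \<in> invariant_measures f" "a = real n *\<^sub>R rot F \<mu>"
        by (auto simp: rotation_set_def)
      have "\<psi> ((F ^^ n) z - z) - \<psi> a = \<psi> ((F ^^ n) z - z - a)" by (simp add: lin)
      also have "\<dots> \<le> onorm \<psi> * norm ((F ^^ n) z - z - a)"
        using onorm[OF bl, of "(F ^^ n) z - z - a"] by simp
      also have "\<dots> \<le> onorm \<psi> * (L + \<epsilon>)"
        using a onorm_pos_le[OF bl] by (intro mult_left_mono) (auto simp: dist_norm)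
      finally have "\<psi> ((F ^^ n) z - z) \<le> \<psi> a + onorm \<psi> * (L + \<epsilon>)" by simp
      moreover have "\<psi> a \<le> real n * \<alpha>" using \<alpha>[OF \<mu>(1)] by (simp add: \<mu>(2) lin mult_left_mono)
      ultimately show ?thesis by (simp add: C_def algebra_simps)
    qed
    then have "\<forall>\<^sub>F \<epsilon> in at_right 0. \<psi> ((F ^^ n) z - z) - real n * \<alpha> \<le> C + onorm \<psi> * \<epsilon>"
      by (auto intro: eventually_at_rightI[of 0 1])
    moreover have "((\<lambda>\<epsilon>. C + onorm \<psi> * \<epsilon>) \<longlongrightarrow> C + onorm \<psi> * 0) (at_right 0)"
      by (intro tendsto_intros)
    ultimately have "\<psi> ((F ^^ n) z - z) - real n * \<alpha> \<le> C + onorm \<psi> * 0"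
      by (intro tendsto_lowerbound) auto
    then show ?thesis using S_proj[of n z] by (simp add: z_def lin)
  qed

  \<comment> \<open>Supports of maximizing measures\<close>
  have closed_E: "closed {q. \<forall>n. \<bar>S n q\<bar> \<le> C}"
    by (intro closed_Collect_all closed_Collect_le continuous_intros S_cont)
  have "supp \<mu> \<subseteq> {q. \<forall>n. \<bar>S n q\<bar> \<le> C}" if "\<mu> \<in> maximizing_measures f F \<psi>" for \<mu>
  proof -
    have \<mu>: "\<mu> \<in> invariant_measures f" and max: "\<psi> (rot F \<mu>) = \<alpha>"
      using that by (auto simp: maximizing_measures_def \<alpha>_def)
    interpret prob_space \<mu> using \<mu> by (simp add: invariant_measures_def)
    have sets: "sets \<mu> = sets borel" using \<mu> by (simp add: invariant_measures_def)
    have "AE q in \<mu>. \<forall>n. \<bar>\<Sum>i<n. g ((f ^^ i) q)\<bar> \<le> C"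
    proof (rule birkhoff_sum_bounded_AE[OF \<mu>])
      show "integrable \<mu> g" "(\<integral>q. g q \<partial>\<mu>) = 0"
        unfolding g_def using int_\<phi>[OF \<mu>] rot[OF \<mu>] max prob_space by auto
    qed (use S_le in \<open>auto simp: S_def\<close>)
    then show ?thesis by (intro AE_closed_imp_supp_subset[OF sets closed_E]) (simp add: S_def)
  qed
  then have X: "maximizing_set f F \<psi> \<subseteq> {q. \<forall>n. \<bar>S n q\<bar> \<le> C}"
    unfolding maximizing_set_def by (intro closure_minimal closed_E) auto

  \<comment> \<open>Measures on the maximizing set and orbits above it\<close>
  show ?thesis
  proof (intro conjI ballI allI impI)
    fix \<mu> assume \<mu>: "\<mu> \<in> invariant_measures f" and supp: "supp \<mu> \<subseteq> maximizing_set f F \<psi>"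
    interpret prob_space \<mu> using \<mu> by (simp add: invariant_measures_def)
    have sets [measurable_cong]: "sets \<mu> = sets borel" using \<mu> by (simp add: invariant_measures_def)
    have AE: "AE q in \<mu>. \<forall>n. \<bar>S n q\<bar> \<le> C"
      using AE_in_closed_superset_of_supp[OF sets order_trans[OF supp X] closed_E] by simp
    define I where "I = (\<integral>q. g q \<partial>\<mu>)"
    have [measurable]: "f ^^ i \<in> borel \<rightarrow>\<^sub>M borel" for i
      using f_pow by (rule borel_measurable_continuous_onI)
    have int_g: "integrable \<mu> g" unfolding g_def using int_\<phi>[OF \<mu>] by simp
    have pow: "integrable \<mu> (\<lambda>q. g ((f ^^ i) q)) \<and> (\<integral>q. g ((f ^^ i) q) \<partial>\<mu>) = I" for i
    proof (induction i)
      case 0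
      then show ?case using int_g by (simp add: I_def)
    next
      case (Suc i)
      have d: "distr \<mu> borel f = \<mu>" using \<mu> by (simp add: invariant_measures_def)
      have "integrable (distr \<mu> borel f) (\<lambda>q. g ((f ^^ i) q))" using Suc by (simp add: d)
      then have "integrable \<mu> (\<lambda>q. g ((f ^^ i) (f q)))" by (subst (asm) integrable_distr_eq) auto
      moreover have "(\<integral>q. g ((f ^^ i) (f q)) \<partial>\<mu>) = (\<integral>q. g ((f ^^ i) q) \<partial>\<mu>)"
        by (rule invariant_measures_integral_comp[OF \<mu> f_meas]) measurable
      ultimately show ?case using Suc by (simp add: funpow_swap1)
    qed
    \<comment> \<open>By invariance all n terms of \<open>S n\<close> have integral I, while
      \<open>S n\<close> stays between -C and C almost everywhere.\<close>
    have "real n * \<bar>I\<bar> \<le> C" for n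
    proof -
      have S_int: "integrable \<mu> (S n)" "(\<integral>q. S n q \<partial>\<mu>) = real n * I"
        unfolding S_def using pow by simp_all
      have "AE q in \<mu>. S n q \<le> C" "AE q in \<mu>. - C \<le> S n q"
        using AE by (auto elim!: eventually_mono dest!: spec[of _ n])
      then have "real n * I \<le> C" "- C \<le> real n * I"
        unfolding S_int(2)[symmetric]
        using integral_le_const[OF S_int(1)] integral_ge_const[OF S_int(1)] by simp_all
      then show ?thesis by (simp add: abs_if)
    qed
    \<comment> \<open>C does not depend on n, which forces I = 0; as \<mu> has mass 1, I is the
      difference of \<open>\<psi> (rot F \<mu>)\<close> and \<alpha>.\<close>
    then have "\<bar>I\<bar> = 0"
      using reals_Archimedean3[of "\<bar>I\<bar>"] by (metis abs_ge_zero less_eq_real_def not_le)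
    then have "\<psi> (rot F \<mu>) = \<alpha>"
      using rot[OF \<mu>] int_\<phi>[OF \<mu>] prob_space by (simp add: I_def g_def)
    then show "\<mu> \<in> maximizing_measures f F \<psi>"
      using \<mu> by (simp add: maximizing_measures_def \<alpha>_def)
  next
    fix z :: "real^2" and n :: nat
    assume "torus_proj z \<in> maximizing_set f F \<psi>" "1 \<le> n"
    then have "\<bar>S n (torus_proj z)\<bar> \<le> C" using X by auto
    then show "\<bar>\<psi> ((F ^^ n) z) - \<psi> z - real n * max_rot f F \<psi>\<bar> \<le> L * onorm \<psi>"
      by (simp add: S_proj C_def \<alpha>_def)
  qed
qed

end
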